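(* Consider the following "stochastic chasing $0$ game" with constants $c>0$, $R>0$ and dimension $m$. Start with $x^{(1)}=0\in\mathbb{R}^m$. In each round $k=1,2,\dots$: a stochastic adversary (possibly depending on the history) picks a probability distribution $\mathcal{D}^{(k)}$ on $\mathbb{R}^m$ with $\mathbb{E}_{\Delta\sim\mathcal{D}^{(k)}}\Delta=0$ and $\|\Delta\|_2\le c$ for all $\Delta$ in its support, and picks $y^{(k)}\in\mathbb{R}^m$ with $\|y^{(k)}-x^{(k)}\|_\infty\le R$; the player, seeing only $y^{(k)}$, picks a coordinate $i^{(k)}$; then $\Delta^{(k)}$ is sampled from $\mathcal{D}^{(k)}$ and $x^{(k+1)}_{i^{(k)}}=0$, $x^{(k+1)}_j=x^{(k)}_j+\Delta^{(k)}_j$ for all $j\ne i^{(k)}$. If the player uses the strategy $i^{(k)}=\arg\max_i|y^{(k)}_i|$, then for any $p\in(0,1)$, with probability at least $1-p$ we have $\|x^{(k)}\|_\infty\le 2(c+R)\log(4mk^2/p)$ simultaneously for all $k$. *)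

theory Defs
  imports "HOL-Probability.Probability"
begin

definition msupport :: "'b::topological_space measure \<Rightarrow> 'b set" where
  "msupport \<mu> = {z. \<forall>U. open U \<longrightarrow> z \<in> U \<longrightarrow> 0 < emeasure \<mu> U}"

(* K is a regular conditional distribution of the random vector X given the sub-sigma-algebra G:
   "given the information in G, X is sampled from K". *)
definition cond_distribution ::
  "'a measure \<Rightarrow> 'a measure \<Rightarrow> ('a \<Rightarrow> 'b::topological_space) \<Rightarrow> ('a \<Rightarrow> 'b measure) \<Rightarrow> bool" where
  "cond_distribution M G X K \<longleftrightarrow>
     K \<in> measurable G (prob_algebra borel) \<and>
     (\<forall>B\<in>sets borel. AE \<omega> in M.
        real_cond_exp M G (\<lambda>\<omega>'. indicat_real B (X \<omega>')) \<omega> = measure (K \<omega>) B)"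

(* A play of the stochastic chasing 0 game in R^m, m = CARD('n), on a probability space M.
   Rounds are numbered 1, 2, ...  F k is the history available to the adversary when round k starts:
   it contains all samples of the earlier rounds and possibly private randomness of the adversary.
   D k and y k are the adversary's choices, \<Delta> k is the sample, and the player's choice in
   round k is pick k (y k), so it depends on the observation y k only. *)
locale stochastic_chasing_zero_game = prob_space M + filtration "space M" F
  for M :: "'a measure" and F :: "nat \<Rightarrow> 'a measure" +
  fixes c R :: real
    and D :: "nat \<Rightarrow> 'a \<Rightarrow> (real ^ 'n) measure"
    and y :: "nat \<Rightarrow> 'a \<Rightarrow> real ^ 'n"
    and pick :: "nat \<Rightarrow> real ^ 'n \<Rightarrow> 'n::finite"
    and \<Delta> :: "nat \<Rightarrow> 'a \<Rightarrow> real ^ 'n"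
    and x :: "nat \<Rightarrow> 'a \<Rightarrow> real ^ 'n"
  assumes c_pos: "c > 0" and R_pos: "R > 0"
    and history: "\<And>k. subalgebra M (F k)"
    and x_start: "\<And>\<omega>. \<omega> \<in> space M \<Longrightarrow> x 1 \<omega> = 0"
    and D_mean: "\<And>k \<omega>. k \<ge> 1 \<Longrightarrow> \<omega> \<in> space M \<Longrightarrow> has_bochner_integral (D k \<omega>) (\<lambda>z. z) 0"
    and D_support: "\<And>k \<omega> z. k \<ge> 1 \<Longrightarrow> \<omega> \<in> space M \<Longrightarrow> z \<in> msupport (D k \<omega>) \<Longrightarrow> norm z \<le> c"
    and y_measurable: "\<And>k. k \<ge> 1 \<Longrightarrow> y k \<in> borel_measurable (F k)"
    and y_close: "\<And>k \<omega>. k \<ge> 1 \<Longrightarrow> \<omega> \<in> space M \<Longrightarrow> infnorm (y k \<omega> - x k \<omega>) \<le> R"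
    and pick_measurable: "\<And>k. k \<ge> 1 \<Longrightarrow> pick k \<in> measurable borel (count_space UNIV)"
    and \<Delta>_measurable: "\<And>k. k \<ge> 1 \<Longrightarrow> \<Delta> k \<in> borel_measurable (F (Suc k))"
    and \<Delta>_sampled: "\<And>k. k \<ge> 1 \<Longrightarrow> cond_distribution M (F k) (\<Delta> k) (D k)"
    and x_step: "\<And>k \<omega> j. k \<ge> 1 \<Longrightarrow> \<omega> \<in> space M \<Longrightarrow>
      x (Suc k) \<omega> $ j = (if j = pick k (y k \<omega>) then 0 else x k \<omega> $ j + \<Delta> k \<omega> $ j)"

(* Ties may be broken arbitrarily. *)
definition argmax_strategy :: "(nat \<Rightarrow> real ^ 'n \<Rightarrow> 'n) \<Rightarrow> bool" where
  "argmax_strategy pick \<longleftrightarrow>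
     (\<forall>k\<ge>1. \<forall>v. is_arg_max (\<lambda>i. \<bar>v $ i\<bar>) (\<lambda>_. True) (pick k v))"

end

theory Submission
  imports Defs "HOL-Real_Asymp.Real_Asymp"
begin

text \<open>
  With \<open>l = 1 / (2 (c + R))\<close> consider the potential \<open>\<Phi>(u) = (\<Sum>j. cosh (l u\<^sub>j))\<close>. The noise has
  conditional mean zero, so the first-order terms vanish in expectation, and the second-order terms
  add at most \<open>(l c)\<^sup>2\<close> times the largest summand. Since the player sees every coordinate up to an
  error \<open>R\<close>, the summand that is reset is at least \<open>exp (- 2 l R)\<close> times the largest one, hence a
  fixed multiple of \<open>\<Phi> / m\<close> in excess of the noise. This drift keeps the expectation of \<open>\<Phi>\<close> below
  \<open>3 m\<close> forever. Markov's inequality bounds the failure probability of round \<open>k\<close> by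
  \<open>3 p / (2 k\<^sup>2)\<close>; round \<open>1\<close> cannot fail, and the bounds for \<open>k \<ge> 2\<close> sum to at most \<open>p\<close>.
\<close>

section \<open>Elementary inequalities for \<open>exp\<close> and \<open>cosh\<close>\<close>

text \<open>For negative \<open>b\<close>, with \<open>t = - b\<close>, it suffices that
  \<open>exp t * (1 - t + t\<^sup>2)\<close> is at least 1. This follows from
  \<open>exp t \<ge> 1 + t\<close> and the factorisation of \<open>1 + t ^ 3\<close>.\<close>

lemma exp_le_quadratic:
  fixes b :: real
  assumes "\<bar>b\<bar> \<le> 1"
  shows "exp b \<le> 1 + b + b\<^sup>2"
proof (cases "b \<ge> 0")
  case True
  then show ?thesis using exp_bound[of b] assms by simp
next
  case False
  define t where "t = - b"
  have t: "0 < t" "t \<le> 1" using False assms by (auto simp: t_def)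
  have "1 \<le> (1 + t) * (1 - t + t\<^sup>2)"
  proof -
    have "(1 + t) * (1 - t + t\<^sup>2) = 1 + t ^ 3"
      by (simp add: power2_eq_square power3_eq_cube algebra_simps)
    then show ?thesis using t by simp
  qed
  also have "\<dots> \<le> exp t * (1 - t + t\<^sup>2)"
    using t exp_ge_add_one_self[of t] by (intro mult_right_mono) auto
  finally have "exp (- t) \<le> 1 - t + t\<^sup>2"
    by (simp add: exp_minus field_simps)
  then show ?thesis by (simp add: t_def)
qed

text \<open>Applying the quadratic bound to \<open>b\<close> and to \<open>- b\<close> makes the
  linear terms recombine into \<open>b * sinh a\<close>. That term is kept separate because it is
  the one that vanishes in expectation.\<close>

lemma cosh_add_le:
  fixes a b :: real
  assumes "\<bar>b\<bar> \<le> 1"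
  shows "cosh (a + b) \<le> cosh a + b\<^sup>2 * cosh a + b * sinh a"
proof -
  have "exp a * exp b \<le> exp a * (1 + b + b\<^sup>2)"
    using exp_le_quadratic[OF assms] by (intro mult_left_mono) auto
  moreover have "exp (- a) * exp (- b) \<le> exp (- a) * (1 - b + b\<^sup>2)"
    using exp_le_quadratic[of "- b"] assms by (intro mult_left_mono) auto
  ultimately show ?thesis
    by (simp add: cosh_field_def sinh_field_def mult_exp_exp add_divide_distrib diff_divide_distrib
        algebra_simps)
qed

lemma cosh_add_le_exp_mult:
  fixes a b :: real
  assumes "b \<ge> 0"
  shows "cosh (a + b) \<le> exp b * cosh a"
proof -
  have "exp (- (a + b)) \<le> exp (b - a)" using assms by simp
  then show ?thesis
    by (simp add: cosh_def exp_add[symmetric] distrib_left algebra_simps)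
qed

text \<open>Here \<open>s\<close> will be \<open>c / (c + R)\<close>. Relative to a common bound on
  all summands, \<open>exp (s - 1)\<close> is what a reset gains and \<open>s\<^sup>2 / 4\<close>
  what the noise costs, so the net gain is bounded below uniformly in the ratio of \<open>c\<close>
  and \<open>R\<close>. The estimate rests on e \<le> 3 and the quadratic Taylor bound for
  \<open>exp s\<close>.\<close>

lemma exp_minus_square_ge_third:
  fixes s :: real
  assumes "0 \<le> s" "s \<le> 1"
  shows "exp (s - 1) - s\<^sup>2 / 4 \<ge> 1 / 3"
proof -
  have "1 / 3 + s / 3 + s\<^sup>2 / 6 = (1 / 3) * (1 + s + s\<^sup>2 / 2)" by (simp add: field_simps)
  also have "\<dots> \<le> exp (- 1) * exp s"
  proof (rule mult_mono)
    show "1 / 3 \<le> exp (- 1 :: real)" using exp_le by (simp add: exp_minus field_simps)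
    show "1 + s + s\<^sup>2 / 2 \<le> exp s" using exp_lower_Taylor_quadratic[of s] assms by simp
  qed (use assms in auto)
  also have "\<dots> = exp (s - 1)" by (simp add: exp_diff exp_minus field_simps)
  finally have "1 / 3 + s / 3 + s\<^sup>2 / 6 \<le> exp (s - 1)" .
  moreover have "s\<^sup>2 \<le> s" using assms by (simp add: power2_eq_square mult_left_le_one_le)
  ultimately show ?thesis using assms by linarith
qed

section \<open>The potential and its one-step drift\<close>

text \<open>A smooth stand-in for the maximum norm: for \<open>l \<ge> 0\<close> it lies between
  \<open>exp (l * infnorm u) / 2\<close> and m times \<open>exp (l * infnorm u)\<close>, where m is
  the dimension.\<close>

definition potential :: "real \<Rightarrow> real ^ 'n \<Rightarrow> real" where
  "potential l u = (\<Sum>j\<in>UNIV. cosh (l * u $ j))"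

text \<open>A pathwise bound. The first-order sum is left standing, since its coefficients depend on
  \<open>u\<close> and \<open>i\<close> only and are thus fixed before the noise \<open>d\<close> is
  drawn. The added 1 is \<open>cosh 0\<close> at the reset coordinate.\<close>

lemma potential_reset_step:
  fixes u d u' :: "real ^ 'n"
  assumes c: "c > 0" and R: "R > 0" and l: "l = 1 / (2 * (c + R))"
    and d: "norm d \<le> c"
    and u: "\<And>j. \<bar>u $ j\<bar> \<le> \<bar>u $ i\<bar> + 2 * R"
    and u': "\<And>j. u' $ j = (if j = i then 0 else u $ j + d $ j)"
  shows "potential l u' \<le> (1 - 1 / (3 * real CARD('n))) * potential l u + 1
           + (\<Sum>j\<in>UNIV. (if j = i then 0 else l * sinh (l * u $ j)) * d $ j)"
proof -
  \<comment> \<open>The choice of \<open>l\<close> gives \<open>l * c = s / 2\<close> and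
    \<open>l * (2 * R) = 1 - s\<close>, so a single parameter measures both noise and observation
    error.\<close>
  define s where "s = c / (c + R)"
  \<comment> \<open>\<open>B\<close> will dominate every summand, since no coordinate exceeds
    coordinate \<open>i\<close> by more than \<open>2 * R\<close> in absolute value.\<close>
  define B where "B = exp (1 - s) * cosh (l * u $ i)"
  have s: "0 \<le> s" "s \<le> 1" using c R by (auto simp: s_def)
  have l_pos: "l > 0" and lc: "l * c = s / 2" and lR: "l * (2 * R) = 1 - s"
    using c R by (auto simp: l s_def field_simps)
  have B_pos: "B \<ge> 0" by (simp add: B_def)
  have cosh_le_B: "cosh (l * u $ j) \<le> B" for j
  proof -
    have "cosh (l * u $ j) = cosh (l * \<bar>u $ j\<bar>)"
      using cosh_real_abs[of "l * u $ j"] l_pos by (simp add: abs_mult)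
    also have "\<dots> \<le> cosh (l * \<bar>u $ i\<bar> + (1 - s))"
    proof -
      have "l * \<bar>u $ j\<bar> \<le> l * (\<bar>u $ i\<bar> + 2 * R)"
        using u l_pos by (intro mult_left_mono) auto
      then show ?thesis
        using lR l_pos s by (subst cosh_real_nonneg_le_iff) (auto simp: distrib_left)
    qed
    also have "\<dots> \<le> exp (1 - s) * cosh (l * \<bar>u $ i\<bar>)"
      using s by (intro cosh_add_le_exp_mult) auto
    also have "\<dots> = B"
      using cosh_real_abs[of "l * u $ i"] l_pos by (simp add: B_def abs_mult)
    finally show ?thesis .
  qed
  have cosh_i: "cosh (l * u $ i) = exp (s - 1) * B"
    by (simp add: B_def mult.assoc[symmetric] exp_add[symmetric])
  let ?Z = "\<lambda>j. if j = i then 0 else l * sinh (l * u $ j)"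
  \<comment> \<open>One estimate for all coordinates: at \<open>j = i\<close> the summand drops from
    \<open>exp (s - 1) * B\<close> to 1, and the quadratic term there is mere slack.\<close>
  have step: "cosh (l * u' $ j) \<le> cosh (l * u $ j) + l\<^sup>2 * B * (d $ j)\<^sup>2 + ?Z j * d $ j
                + (if j = i then 1 - exp (s - 1) * B else 0)" for j
  proof (cases "j = i")
    case True
    then show ?thesis using B_pos by (simp add: u' cosh_i)
  next
    case False
    have "\<bar>d $ j\<bar> \<le> c" using d component_le_norm_cart[of d j] by simp
    then have "l * \<bar>d $ j\<bar> \<le> l * c" using l_pos by (intro mult_left_mono) auto
    then have "\<bar>l * d $ j\<bar> \<le> 1" using lc s l_pos by (simp add: abs_mult)
    from cosh_add_le[OF this, of "l * u $ j"]
    have "cosh (l * u' $ j) \<le> cosh (l * u $ j) + (l * d $ j)\<^sup>2 * cosh (l * u $ j)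
            + l * d $ j * sinh (l * u $ j)"
      using False by (simp add: u' distrib_left)
    also have "(l * d $ j)\<^sup>2 * cosh (l * u $ j) \<le> (l * d $ j)\<^sup>2 * B"
      by (intro mult_left_mono cosh_le_B) auto
    finally show ?thesis using False by (simp add: power_mult_distrib algebra_simps)
  qed
  have "potential l u' \<le> (\<Sum>j\<in>UNIV. cosh (l * u $ j) + l\<^sup>2 * B * (d $ j)\<^sup>2 + ?Z j * d $ j
                + (if j = i then 1 - exp (s - 1) * B else 0))"
    unfolding potential_def by (intro sum_mono step)
  also have "\<dots> = potential l u + l\<^sup>2 * B * (\<Sum>j\<in>UNIV. (d $ j)\<^sup>2) + (\<Sum>j\<in>UNIV. ?Z j * d $ j)
                + (1 - exp (s - 1) * B)"
    by (simp only: sum.distrib potential_def sum_distrib_left) simp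
  also have "(\<Sum>j\<in>UNIV. (d $ j)\<^sup>2) = (norm d)\<^sup>2"
    by (simp add: norm_vec_def L2_set_def sum_nonneg)
  also have "l\<^sup>2 * B * (norm d)\<^sup>2 \<le> s\<^sup>2 / 4 * B"
  proof -
    have "l\<^sup>2 * B * (norm d)\<^sup>2 \<le> l\<^sup>2 * B * c\<^sup>2"
      using d B_pos by (intro mult_left_mono power_mono) auto
    also have "\<dots> = (l * c)\<^sup>2 * B" by (simp add: power_mult_distrib)
    finally show ?thesis by (simp add: lc power_divide)
  qed
  finally have "potential l u' \<le> potential l u + 1 + (\<Sum>j\<in>UNIV. ?Z j * d $ j)
                  - (exp (s - 1) - s\<^sup>2 / 4) * B"
    by (simp add: left_diff_distrib)
  moreover have "(exp (s - 1) - s\<^sup>2 / 4) * B \<ge> 1 / 3 * B"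
    using exp_minus_square_ge_third[OF s] B_pos by (rule mult_right_mono)
  \<comment> \<open>Each of the m summands is at most \<open>B\<close>, so a gain of
    \<open>B / 3\<close> is at least a fraction 1/(3m) of the potential.\<close>
  moreover have "1 / (3 * real CARD('n)) * potential l u \<le> 1 / 3 * B"
  proof -
    have "potential l u \<le> (\<Sum>j\<in>(UNIV :: 'n set). B)"
      unfolding potential_def by (intro sum_mono cosh_le_B)
    then have "potential l u \<le> real CARD('n) * B" by simp
    then have "1 / (3 * real CARD('n)) * potential l u \<le> 1 / (3 * real CARD('n)) * (real CARD('n) * B)"
      by (rule mult_left_mono) simp
    then show ?thesis by simp
  qed
  moreover have "(1 - 1 / (3 * real CARD('n))) * potential l u
      = potential l u - 1 / (3 * real CARD('n)) * potential l u"
    by (simp only: left_diff_distrib mult_1)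
  ultimately show ?thesis by linarith
qed

section \<open>Supports and regular conditional distributions\<close>

text \<open>Every point of \<open>W\<close> has an open null neighbourhood, and by the Lindelof
  property countably many open null sets already cover \<open>W\<close>.\<close>

lemma emeasure_open_disjoint_msupport:
  fixes \<mu> :: "'b::second_countable_topology measure"
  assumes sets: "sets \<mu> = sets borel" and "open W" and disj: "W \<inter> msupport \<mu> = {}"
  shows "emeasure \<mu> W = 0"
proof -
  define N where "N = {U. open U \<and> emeasure \<mu> U = 0}"
  obtain N' where N': "N' \<subseteq> N" "countable N'" "\<Union>N' = \<Union>N"
    using Lindelof[of N] by (auto simp: N_def)
  have "\<Union>N' \<in> null_sets \<mu>"
  proof -
    have "U \<in> null_sets \<mu>" if "U \<in> N'" for U
      using that N'(1) sets by (auto simp: N_def null_sets_def)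
    then show ?thesis using null_sets_UN'[of N' "\<lambda>U. U" \<mu>] N'(2) by simp
  qed
  moreover have "W \<subseteq> \<Union>N'"
  proof
    fix z assume "z \<in> W"
    then have "z \<notin> msupport \<mu>" using disj by blast
    then obtain U where "open U" "z \<in> U" "emeasure \<mu> U = 0"
      by (auto simp: msupport_def)
    then have "z \<in> \<Union>N" by (auto simp: N_def)
    then show "z \<in> \<Union>N'" by (simp add: N'(3))
  qed
  moreover have "W \<in> sets \<mu>" using sets \<open>open W\<close> by simp
  ultimately show ?thesis
    by (meson null_setsD1 null_sets_subset)
qed

text \<open>On the event \<open>A\<close>, the law of \<open>X\<close> is the mixture of the kernels
  \<open>K \<omega>\<close>. This carries facts about the individual kernels over to the sample
  itself.\<close>

lemma nn_integral_cond_distribution: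
  fixes X :: "'a \<Rightarrow> 'b::topological_space"
  assumes "prob_space M" and sub: "subalgebra M G" and X[measurable]: "X \<in> borel_measurable M"
    and K: "cond_distribution M G X K"
    and A: "A \<in> sets G" and g[measurable]: "g \<in> borel_measurable borel"
  shows "(\<integral>\<^sup>+\<omega>\<in>A. g (X \<omega>) \<partial>M) = (\<integral>\<^sup>+\<omega>\<in>A. (\<integral>\<^sup>+z. g z \<partial>K \<omega>) \<partial>M)"
proof -
  interpret prob_space M by fact
  interpret finite_measure_subalgebra M G by unfold_locales (rule sub)
  have AM[measurable]: "A \<in> sets M" using A sub by (auto simp: subalgebra_def)
  have KG: "K \<in> measurable G (prob_algebra borel)" using K by (simp add: cond_distribution_def)
  have [measurable]: "K \<in> measurable M (prob_algebra borel)"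
    using measurable_from_subalg[OF sub KG] .
  then have [measurable]: "K \<in> measurable M (subprob_algebra borel)"
    by (rule measurable_prob_algebraD)
  define MA where "MA = density M (indicator A)"
  have KMA: "K \<in> measurable MA (subprob_algebra borel)" by (simp add: MA_def)
  \<comment> \<open>The two measures are compared on Borel sets \<open>B\<close>, where the defining
    property of conditional expectation applies to the indicator of \<open>B\<close>. That property
    concerns real integrals, hence the passage to Bochner integrals and back.\<close>
  have eq: "distr MA borel X = MA \<bind> K"
  proof (rule measure_eqI)
    show "sets (distr MA borel X) = sets (MA \<bind> K)"
      using KMA by (subst sets_bind[OF sets_kernel[OF KMA]]) (auto simp: MA_def not_empty)
  next
    fix B assume "B \<in> sets (distr MA borel X)"
    then have B[measurable]: "B \<in> sets borel" by simp
    have pK: "prob_space (K \<omega>)" if "\<omega> \<in> space M" for \<omega>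
      using that measurable_space[OF \<open>K \<in> measurable M (prob_algebra borel)\<close>]
      by (auto simp: space_prob_algebra)
    have AE: "AE \<omega> in M. real_cond_exp M G (\<lambda>\<omega>'. indicat_real B (X \<omega>')) \<omega> = measure (K \<omega>) B"
      using K B by (auto simp: cond_distribution_def)
    have mK[measurable]: "(\<lambda>\<omega>. measure (K \<omega>) B) \<in> borel_measurable M" by measurable
    have intK: "integrable M (\<lambda>\<omega>. indicat_real A \<omega> * measure (K \<omega>) B)"
      by (rule integrable_const_bound[of _ 1])
         (auto simp: indicator_def prob_space.prob_le_1[OF pK])
    have intX: "integrable M (\<lambda>\<omega>. indicat_real A \<omega> * indicat_real B (X \<omega>))"
      by (rule integrable_const_bound[of _ 1]) (auto simp: indicator_def)
    have "emeasure (distr MA borel X) B = (\<integral>\<^sup>+\<omega>. ennreal (indicat_real A \<omega> * indicat_real B (X \<omega>)) \<partial>M)"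
      by (simp add: MA_def emeasure_distr emeasure_density)
         (auto intro!: nn_integral_cong simp: indicator_def)
    also have "\<dots> = ennreal (\<integral>\<omega>. indicat_real A \<omega> * indicat_real B (X \<omega>) \<partial>M)"
      by (rule nn_integral_eq_integral[OF intX]) auto
    also have "(\<integral>\<omega>. indicat_real A \<omega> * indicat_real B (X \<omega>) \<partial>M)
        = (\<integral>\<omega>. indicat_real A \<omega> * real_cond_exp M G (\<lambda>\<omega>'. indicat_real B (X \<omega>')) \<omega> \<partial>M)"
      using A by (intro real_cond_exp_intg(2)[symmetric] intX) auto
    also have "\<dots> = (\<integral>\<omega>. indicat_real A \<omega> * measure (K \<omega>) B \<partial>M)"
      using AE by (intro integral_cong_AE) (auto intro: borel_measurable_cond_exp2)
    also have "ennreal \<dots> = (\<integral>\<^sup>+\<omega>. ennreal (indicat_real A \<omega> * measure (K \<omega>) B) \<partial>M)"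
      by (rule nn_integral_eq_integral[OF intK, symmetric]) auto
    also have "\<dots> = (\<integral>\<^sup>+\<omega>. indicator A \<omega> * emeasure (K \<omega>) B \<partial>M)"
      by (intro nn_integral_cong)
         (auto simp: indicator_def finite_measure.emeasure_eq_measure[OF prob_space.finite_measure[OF pK]])
    also have "\<dots> = emeasure (MA \<bind> K) B"
      using not_empty by (subst emeasure_bind[OF _ KMA B]) (auto simp: MA_def nn_integral_density)
    finally show "emeasure (distr MA borel X) B = emeasure (MA \<bind> K) B" .
  qed
  have "(\<integral>\<^sup>+\<omega>\<in>A. g (X \<omega>) \<partial>M) = (\<integral>\<^sup>+z. g z \<partial>distr MA borel X)"
    by (simp add: MA_def nn_integral_distr nn_integral_density mult.commute)
  also have "\<dots> = (\<integral>\<^sup>+\<omega>. (\<integral>\<^sup>+z. g z \<partial>K \<omega>) \<partial>MA)"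
    unfolding eq by (rule nn_integral_bind[OF g KMA])
  also have "\<dots> = (\<integral>\<^sup>+\<omega>\<in>A. (\<integral>\<^sup>+z. g z \<partial>K \<omega>) \<partial>M)"
    by (simp add: MA_def nn_integral_density mult.commute)
  finally show ?thesis .
qed

section \<open>Coordinatewise norm bounds, measurability and hyperbolic functions\<close>

lemma infnorm_le_iff_cart:
  fixes v :: "real ^ 'n"
  shows "infnorm v \<le> t \<longleftrightarrow> (\<forall>j. \<bar>v $ j\<bar> \<le> t)"
proof
  assume "infnorm v \<le> t"
  then show "\<forall>j. \<bar>v $ j\<bar> \<le> t" using component_le_infnorm_cart order_trans by blast
next
  assume "\<forall>j. \<bar>v $ j\<bar> \<le> t"
  then show "infnorm v \<le> t" unfolding infnorm_cart by (intro cSup_least) auto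
qed

lemma borel_measurable_vecI:
  fixes f :: "'a \<Rightarrow> real ^ 'n"
  assumes "\<And>j. (\<lambda>\<omega>. f \<omega> $ j) \<in> borel_measurable N"
  shows "f \<in> borel_measurable N"
  using assms by (subst borel_measurable_euclidean_space) (auto simp: Basis_vec_def inner_axis)

lemma borel_measurable_vec_nth [measurable]:
  "(\<lambda>v :: real ^ 'n. v $ j) \<in> borel_measurable borel"
  by (intro borel_measurable_continuous_onI continuous_intros)

lemma borel_measurable_cosh_sinh [measurable]:
  "(cosh :: real \<Rightarrow> real) \<in> borel_measurable borel"
  "(sinh :: real \<Rightarrow> real) \<in> borel_measurable borel"
  by (intro borel_measurable_continuous_onI continuous_intros)+

lemma abs_sinh_le_cosh: "\<bar>sinh (a :: real)\<bar> \<le> cosh a"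
  using sinh_less_cosh_real[of "\<bar>a\<bar>"] by simp

lemma cosh_mono_abs: "\<bar>a\<bar> \<le> b \<Longrightarrow> cosh a \<le> cosh (b :: real)"
  using cosh_real_nonneg_le_iff[of "\<bar>a\<bar>" b] by simp

section \<open>Boundedness and conditional mean of the noise\<close>

context stochastic_chasing_zero_game
begin

lemma measurable_F_Suc: "f \<in> measurable (F k) N \<Longrightarrow> f \<in> measurable (F (Suc k)) N"
  using sets_F_mono[of k "Suc k"] space_F by (auto simp: measurable_def)

lemma measurable_M_of_F: "f \<in> measurable (F k) N \<Longrightarrow> f \<in> measurable M N"
  using measurable_from_subalg[OF history] .

lemma \<Delta>_measurable_M:
  assumes "k \<ge> 1"
  shows "\<Delta> k \<in> borel_measurable M"
  using \<Delta>_measurable[OF assms] by (rule measurable_M_of_F)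

lemma D_prob_algebra:
  assumes "k \<ge> 1" "\<omega> \<in> space M"
  shows "prob_space (D k \<omega>)" "sets (D k \<omega>) = sets borel"
proof -
  have "D k \<in> measurable (F k) (prob_algebra borel)"
    using \<Delta>_sampled[OF assms(1)] by (simp add: cond_distribution_def)
  from measurable_space[OF measurable_M_of_F[OF this] assms(2)]
  show "prob_space (D k \<omega>)" "sets (D k \<omega>) = sets borel"
    by (auto simp: space_prob_algebra)
qed

lemma emeasure_D_norm_gt:
  assumes "k \<ge> 1" "\<omega> \<in> space M"
  shows "emeasure (D k \<omega>) {z. c < norm z} = 0"
proof (rule emeasure_open_disjoint_msupport)
  show "sets (D k \<omega>) = sets borel" by (rule D_prob_algebra[OF assms])
  show "open {z::real^'n. c < norm z}" by (intro open_Collect_less continuous_intros)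
  show "{z. c < norm z} \<inter> msupport (D k \<omega>) = {}"
    using D_support[OF assms] by fastforce
qed

text \<open>The indicator of norm greater than \<open>c\<close> is disintegrated over the whole
  space. Every \<open>D k \<omega>\<close> gives this set mass 0, as it is open and misses the
  support.\<close>

lemma AE_norm_\<Delta>_le:
  assumes "k \<ge> 1"
  shows "AE \<omega> in M. norm (\<Delta> k \<omega>) \<le> c"
proof -
  note [measurable] = \<Delta>_measurable_M[OF assms]
  let ?g = "indicator {z. c < norm z} :: real ^ 'n \<Rightarrow> ennreal"
  have S: "{z::real^'n. c < norm z} \<in> sets borel" by measurable
  have "(\<integral>\<^sup>+\<omega>\<in>space M. ?g (\<Delta> k \<omega>) \<partial>M) = (\<integral>\<^sup>+\<omega>\<in>space M. (\<integral>\<^sup>+z. ?g z \<partial>D k \<omega>) \<partial>M)"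
    by (rule nn_integral_cond_distribution[OF prob_space_axioms history _ \<Delta>_sampled[OF assms]])
       (auto simp: space_F[symmetric, of k])
  also have "\<dots> = (\<integral>\<^sup>+\<omega>. 0 \<partial>M)"
    using emeasure_D_norm_gt[OF assms] S D_prob_algebra(2)[OF assms]
    by (intro nn_integral_cong) (auto simp: indicator_def[of "space M"])
  finally have "AE \<omega> in M. ?g (\<Delta> k \<omega>) * indicator (space M) \<omega> = 0"
    using nn_integral_0_iff_AE[of "\<lambda>\<omega>. ?g (\<Delta> k \<omega>) * indicator (space M) \<omega>" M] by simp
  then show ?thesis
    using AE_space by eventually_elim (auto simp: indicator_def split: if_splits)
qed

lemma AE_abs_\<Delta>_le:
  assumes "k \<ge> 1"
  shows "AE \<omega> in M. \<bar>\<Delta> k \<omega> $ j\<bar> \<le> c"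
  using AE_norm_\<Delta>_le[OF assms] by eventually_elim (metis component_le_norm_cart order_trans)

text \<open>The shift by \<open>c\<close> makes the coordinate nonnegative almost everywhere, so
  that the zero mean takes the form of a nonnegative integral, to which the disintegration
  applies.\<close>

lemma nn_integral_D_shifted:
  assumes "k \<ge> 1" "\<omega> \<in> space M"
  shows "(\<integral>\<^sup>+z. ennreal (z $ j + c) \<partial>D k \<omega>) = ennreal c"
proof -
  interpret D: prob_space "D k \<omega>" by (rule D_prob_algebra[OF assms])
  have S: "{z::real^'n. c < norm z} \<in> sets (D k \<omega>)" using D_prob_algebra(2)[OF assms] by simp
  have AE: "AE z in D k \<omega>. 0 \<le> z $ j + c"
  proof (rule AE_I[OF _ emeasure_D_norm_gt[OF assms] S], safe)
    fix z :: "real ^ 'n" assume "\<not> 0 \<le> z $ j + c"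
    then show "c < norm z" using component_le_norm_cart[of z j] by linarith
  qed
  have "has_bochner_integral (D k \<omega>) (\<lambda>z. z $ j) (0 $ j)"
    using has_bochner_integral_bounded_linear[OF bounded_linear_vec_nth D_mean[OF assms]] .
  then have *: "has_bochner_integral (D k \<omega>) (\<lambda>z. z $ j + c) (0 + c)"
    using has_bochner_integral_add[OF _ has_bochner_integral_integrable[OF D.integrable_const[of c]]]
    by (fastforce simp: D.prob_space)
  show ?thesis
    using nn_integral_eq_integral[OF integrable.intros[OF *] AE] has_bochner_integral_integral_eq[OF *]
    by simp
qed

text \<open>On each event \<open>A\<close> of the history, the shifted coordinate and the constant
  \<open>c\<close> have the same integral by disintegration. Removing the shift leaves 0, which
  characterises the conditional expectation.\<close>

lemma real_cond_exp_\<Delta>: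
  assumes k: "k \<ge> 1"
  shows "AE \<omega> in M. real_cond_exp M (F k) (\<lambda>\<omega>. \<Delta> k \<omega> $ j) \<omega> = 0"
proof -
  interpret finite_measure_subalgebra M "F k" by unfold_locales (rule history)
  note [measurable] = \<Delta>_measurable_M[OF k]
  have int: "integrable M (\<lambda>\<omega>. \<Delta> k \<omega> $ j)"
    using AE_abs_\<Delta>_le[OF k, of j] by (intro integrable_const_bound[of _ c]) auto
  show ?thesis
  proof (rule real_cond_exp_charact)
    fix A assume A: "A \<in> sets (F k)"
    then have [measurable]: "A \<in> sets M" using history[of k] by (auto simp: subalgebra_def)
    have intA: "integrable M (\<lambda>\<omega>. indicator A \<omega> * \<Delta> k \<omega> $ j)"
      using integrable_mult_indicator[OF _ int, of A] by simp
    have intc: "integrable M (\<lambda>\<omega>. indicator A \<omega> * c)"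
      by (rule integrable_const_bound[of _ c]) (use c_pos in \<open>auto simp: indicator_def\<close>)
    have "(\<integral>\<^sup>+\<omega>. ennreal (indicator A \<omega> * \<Delta> k \<omega> $ j + indicator A \<omega> * c) \<partial>M)
        = (\<integral>\<^sup>+\<omega>\<in>A. ennreal (\<Delta> k \<omega> $ j + c) \<partial>M)"
      by (intro nn_integral_cong) (auto simp: indicator_def)
    also have "\<dots> = (\<integral>\<^sup>+\<omega>\<in>A. (\<integral>\<^sup>+z. ennreal (z $ j + c) \<partial>D k \<omega>) \<partial>M)"
      by (rule nn_integral_cond_distribution[OF prob_space_axioms history _ \<Delta>_sampled[OF k] A]) auto
    also have "\<dots> = (\<integral>\<^sup>+\<omega>. ennreal (indicator A \<omega> * c) \<partial>M)"
      using nn_integral_D_shifted[OF k] by (intro nn_integral_cong) (auto simp: indicator_def)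
    also have "\<dots> = ennreal (\<integral>\<omega>. indicator A \<omega> * c \<partial>M)"
      using c_pos by (intro nn_integral_eq_integral intc) auto
    also have "(\<integral>\<^sup>+\<omega>. ennreal (indicator A \<omega> * \<Delta> k \<omega> $ j + indicator A \<omega> * c) \<partial>M)
        = ennreal (\<integral>\<omega>. indicator A \<omega> * \<Delta> k \<omega> $ j + indicator A \<omega> * c \<partial>M)"
    proof (intro nn_integral_eq_integral Bochner_Integration.integrable_add intA intc)
      show "AE \<omega> in M. 0 \<le> indicator A \<omega> * \<Delta> k \<omega> $ j + indicator A \<omega> * c"
        using AE_abs_\<Delta>_le[OF k, of j] by eventually_elim (auto simp: indicator_def)
    qed
    finally have eq: "ennreal (\<integral>\<omega>. indicator A \<omega> * \<Delta> k \<omega> $ j + indicator A \<omega> * c \<partial>M)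
        = ennreal (\<integral>\<omega>. indicator A \<omega> * c \<partial>M)" .
    \<comment> \<open>\<open>ennreal\<close> sends every negative real to 0, so the real integrals
      can be equated only once both are known to be nonnegative.\<close>
    have "0 \<le> (\<integral>\<omega>. indicator A \<omega> * \<Delta> k \<omega> $ j + indicator A \<omega> * c \<partial>M)"
    proof (rule integral_nonneg_AE)
      show "AE \<omega> in M. 0 \<le> indicator A \<omega> * \<Delta> k \<omega> $ j + indicator A \<omega> * c"
        using AE_abs_\<Delta>_le[OF k, of j] by eventually_elim (auto simp: indicator_def)
    qed
    moreover have "0 \<le> (\<integral>\<omega>. indicator A \<omega> * c \<partial>M)" using c_pos by (intro integral_nonneg_AE) auto
    ultimately have "(\<integral>\<omega>. indicator A \<omega> * \<Delta> k \<omega> $ j + indicator A \<omega> * c \<partial>M)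
        = (\<integral>\<omega>. indicator A \<omega> * c \<partial>M)"
      using eq by simp
    then have "(\<integral>\<omega>. indicator A \<omega> * \<Delta> k \<omega> $ j \<partial>M) = 0"
      using Bochner_Integration.integral_add[OF intA intc] by simp
    then show "(\<integral>\<omega>\<in>A. \<Delta> k \<omega> $ j \<partial>M) = (\<integral>\<omega>\<in>A. 0 \<partial>M)"
      by (simp add: set_lebesgue_integral_def)
  qed (use int in auto)
qed

text \<open>A factor known when the round starts can be pulled out of the conditional expectation,
  and what remains is the zero conditional mean. The bound on \<open>Z\<close> makes the product
  integrable.\<close>

lemma integral_mult_\<Delta>:
  assumes k: "k \<ge> 1" and Z: "Z \<in> borel_measurable (F k)" and bound: "AE \<omega> in M. \<bar>Z \<omega>\<bar> \<le> B"
  shows "integrable M (\<lambda>\<omega>. Z \<omega> * \<Delta> k \<omega> $ j)" "(\<integral>\<omega>. Z \<omega> * \<Delta> k \<omega> $ j \<partial>M) = 0"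
proof -
  interpret finite_measure_subalgebra M "F k" by unfold_locales (rule history)
  note [measurable] = \<Delta>_measurable_M[OF k] measurable_M_of_F[OF Z]
  show int: "integrable M (\<lambda>\<omega>. Z \<omega> * \<Delta> k \<omega> $ j)"
  proof (rule integrable_const_bound[of _ "B * c"])
    show "AE \<omega> in M. norm (Z \<omega> * \<Delta> k \<omega> $ j) \<le> B * c"
      using bound AE_abs_\<Delta>_le[OF k, of j]
      by eventually_elim (auto simp: abs_mult intro!: mult_mono)
  qed measurable
  have "(\<integral>\<omega>. Z \<omega> * \<Delta> k \<omega> $ j \<partial>M)
      = (\<integral>\<omega>. Z \<omega> * real_cond_exp M (F k) (\<lambda>\<omega>. \<Delta> k \<omega> $ j) \<omega> \<partial>M)"
    using Z by (intro real_cond_exp_intg(2)[symmetric] int) auto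
  also have "\<dots> = (\<integral>\<omega>. 0 \<partial>M)"
    using real_cond_exp_\<Delta>[OF k, of j]
    by (intro integral_cong_AE) (auto intro: borel_measurable_cond_exp2)
  finally show "(\<integral>\<omega>. Z \<omega> * \<Delta> k \<omega> $ j \<partial>M) = 0" by simp
qed

section \<open>Measurability and integrability along the play\<close>

lemma pick_y_measurable:
  assumes "k \<ge> 1"
  shows "(\<lambda>\<omega>. pick k (y k \<omega>)) \<in> measurable (F k) (count_space UNIV)"
  using y_measurable[OF assms] pick_measurable[OF assms] by (rule measurable_compose)

text \<open>The step to round \<open>Suc k\<close> uses \<open>\<Delta> k\<close>, known in
  \<open>F (Suc k)\<close>, and the pick, known already in \<open>F k\<close>.\<close>

lemma x_measurable:
  assumes "k \<ge> 1"
  shows "x k \<in> borel_measurable (F k)"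
  using assms
proof (induction k rule: dec_induct)
  case base
  have "x 1 \<in> borel_measurable (F 1) \<longleftrightarrow> (\<lambda>_. 0 :: real ^ 'n) \<in> borel_measurable (F 1)"
    by (intro measurable_cong) (use x_start in \<open>auto simp: space_F\<close>)
  then show ?case by simp
next
  case (step k)
  then have k: "k \<ge> 1" by simp
  note [measurable] = measurable_F_Suc[OF step.IH] \<Delta>_measurable[OF k]
    measurable_F_Suc[OF pick_y_measurable[OF k]]
  show ?case
  proof (rule borel_measurable_vecI)
    fix j
    have "(\<lambda>\<omega>. x (Suc k) \<omega> $ j) \<in> borel_measurable (F (Suc k)) \<longleftrightarrow>
      (\<lambda>\<omega>. if j = pick k (y k \<omega>) then 0 else x k \<omega> $ j + \<Delta> k \<omega> $ j) \<in> borel_measurable (F (Suc k))"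
      by (intro measurable_cong) (simp add: space_F x_step[OF k])
    moreover have "(\<lambda>\<omega>. if j = pick k (y k \<omega>) then 0 else x k \<omega> $ j + \<Delta> k \<omega> $ j)
        \<in> borel_measurable (F (Suc k))"
      by measurable
    ultimately show "(\<lambda>\<omega>. x (Suc k) \<omega> $ j) \<in> borel_measurable (F (Suc k))" by simp
  qed
qed

text \<open>A crude bound that grows with the round; it serves only to make the potential and the
  linear noise terms integrable.\<close>

lemma AE_abs_x_le:
  assumes "k \<ge> 1"
  shows "AE \<omega> in M. \<forall>j. \<bar>x k \<omega> $ j\<bar> \<le> real k * c"
  using assms
proof (induction k rule: dec_induct)
  case base
  then show ?case using c_pos by (intro AE_I2) (simp add: x_start[simplified])
next
  case (step k)
  then have k: "k \<ge> 1" by simp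
  show ?case
    using step.IH AE_norm_\<Delta>_le[OF k] AE_space
  proof eventually_elim
    case (elim \<omega>)
    show ?case
    proof
      fix j
      have "\<bar>x (Suc k) \<omega> $ j\<bar> \<le> \<bar>x k \<omega> $ j\<bar> + \<bar>\<Delta> k \<omega> $ j\<bar>"
        using x_step[OF k elim(3), of j] by auto
      also have "\<dots> \<le> real k * c + c"
        using elim component_le_norm_cart[of "\<Delta> k \<omega>" j] by (intro add_mono) auto
      finally show "\<bar>x (Suc k) \<omega> $ j\<bar> \<le> real (Suc k) * c" by (simp add: algebra_simps)
    qed
  qed
qed

lemma AE_cosh_x_le:
  assumes "k \<ge> 1" "l \<ge> 0"
  shows "AE \<omega> in M. \<forall>j. cosh (l * x k \<omega> $ j) \<le> cosh (l * (real k * c))"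
  using AE_abs_x_le[OF assms(1)]
proof eventually_elim
  case (elim \<omega>)
  show ?case
  proof
    fix j
    have "\<bar>l * x k \<omega> $ j\<bar> = l * \<bar>x k \<omega> $ j\<bar>" using assms(2) by (simp add: abs_mult)
    also have "\<dots> \<le> l * (real k * c)" using elim assms(2) by (intro mult_left_mono) auto
    finally show "cosh (l * x k \<omega> $ j) \<le> cosh (l * (real k * c))" by (rule cosh_mono_abs)
  qed
qed

lemma potential_measurable:
  assumes "k \<ge> 1"
  shows "(\<lambda>\<omega>. potential l (x k \<omega>)) \<in> borel_measurable M"
proof -
  note [measurable] = measurable_M_of_F[OF x_measurable[OF assms]]
  show ?thesis unfolding potential_def by measurable
qed

lemma potential_integrable:
  assumes "k \<ge> 1" "l \<ge> 0"
  shows "integrable M (\<lambda>\<omega>. potential l (x k \<omega>))"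
proof (rule integrable_const_bound[OF _ potential_measurable[OF assms(1)]])
  show "AE \<omega> in M. norm (potential l (x k \<omega>)) \<le> real CARD('n) * cosh (l * (real k * c))"
    using AE_cosh_x_le[OF assms]
  proof eventually_elim
    case (elim \<omega>)
    have "potential l (x k \<omega>) \<ge> 0" by (simp add: potential_def sum_nonneg)
    moreover have "potential l (x k \<omega>) \<le> (\<Sum>j\<in>(UNIV :: 'n set). cosh (l * (real k * c)))"
      unfolding potential_def using elim by (intro sum_mono) auto
    ultimately show ?case by simp
  qed
qed

section \<open>The expected potential and the tail bound for one round\<close>

text \<open>Passing between \<open>x\<close> and \<open>y\<close> costs \<open>R\<close> once at
  \<open>j\<close> and once at the picked coordinate.\<close>

lemma abs_x_le_pick:
  assumes strategy: "argmax_strategy pick" and k: "k \<ge> 1" and \<omega>: "\<omega> \<in> space M"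
  shows "\<bar>x k \<omega> $ j\<bar> \<le> \<bar>x k \<omega> $ pick k (y k \<omega>)\<bar> + 2 * R"
proof -
  have close: "\<bar>y k \<omega> $ j - x k \<omega> $ j\<bar> \<le> R" for j
    using y_close[OF k \<omega>] infnorm_le_iff_cart[of "y k \<omega> - x k \<omega>" R] by simp
  have "\<bar>y k \<omega> $ j\<bar> \<le> \<bar>y k \<omega> $ pick k (y k \<omega>)\<bar>"
    using strategy k by (simp add: argmax_strategy_def is_arg_max_def not_less)
  then show ?thesis
    using close[of j] close[of "pick k (y k \<omega>)"] by linarith
qed

text \<open>In expectation a round sends a bound v to (1 - 1/(3m)) v + 1, whose fixed point is 3m.
  The induction starts below it, at m.\<close>

lemma expectation_potential_le:
  assumes strategy: "argmax_strategy pick" and l: "l = 1 / (2 * (c + R))" and "k \<ge> 1"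
  shows "expectation (\<lambda>\<omega>. potential l (x k \<omega>)) \<le> 3 * real CARD('n)"
  using \<open>k \<ge> 1\<close>
proof (induction k rule: dec_induct)
  case base
  have "expectation (\<lambda>\<omega>. potential l (x 1 \<omega>)) = expectation (\<lambda>_. real CARD('n))"
    by (intro Bochner_Integration.integral_cong) (simp_all add: potential_def x_start[simplified])
  then show ?case by (simp add: prob_space)
next
  case (step k)
  then have k: "k \<ge> 1" by simp
  have l_nonneg: "l \<ge> 0" using c_pos R_pos l by simp
  \<comment> \<open>The coefficient of noise coordinate \<open>j\<close>. It is a function of
    \<open>x k\<close> and \<open>y k\<close>, hence known in \<open>F k\<close>, so its product
    with the noise has expectation 0.\<close>
  define Z where "Z j \<omega> = (if j = pick k (y k \<omega>) then 0 else l * sinh (l * x k \<omega> $ j))" for j \<omega>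
  note [measurable] = x_measurable[OF k] pick_y_measurable[OF k]
  have Z: "Z j \<in> borel_measurable (F k)" for j
    unfolding Z_def by measurable
  have Z_bound: "AE \<omega> in M. \<bar>Z j \<omega>\<bar> \<le> l * cosh (l * (real k * c))" for j
    using AE_cosh_x_le[OF k l_nonneg]
  proof eventually_elim
    case (elim \<omega>)
    have "\<bar>sinh (l * x k \<omega> $ j)\<bar> \<le> cosh (l * (real k * c))"
      using abs_sinh_le_cosh elim order_trans by blast
    then show ?case using l_nonneg by (auto simp: Z_def abs_mult intro!: mult_left_mono)
  qed
  note Z\<Delta> = integral_mult_\<Delta>[OF k Z Z_bound]
  note \<Phi> = potential_integrable[OF k l_nonneg]
  let ?q = "1 - 1 / (3 * real CARD('n))"
  have "AE \<omega> in M. potential l (x (Suc k) \<omega>)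
      \<le> ?q * potential l (x k \<omega>) + 1 + (\<Sum>j\<in>UNIV. Z j \<omega> * \<Delta> k \<omega> $ j)"
    using AE_norm_\<Delta>_le[OF k] AE_space
  proof eventually_elim
    case (elim \<omega>)
    show ?case
      unfolding Z_def
      by (rule potential_reset_step[OF c_pos R_pos l elim(1)])
         (auto simp: abs_x_le_pick[OF strategy k elim(2)] x_step[OF k elim(2)])
  qed
  then have "expectation (\<lambda>\<omega>. potential l (x (Suc k) \<omega>))
      \<le> expectation (\<lambda>\<omega>. ?q * potential l (x k \<omega>) + 1 + (\<Sum>j\<in>UNIV. Z j \<omega> * \<Delta> k \<omega> $ j))"
    using Z\<Delta>(1) \<Phi> potential_integrable[of "Suc k" l] l_nonneg
    by (intro integral_mono_AE) auto
  also have "\<dots> = ?q * expectation (\<lambda>\<omega>. potential l (x k \<omega>)) + 1"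
    using Z\<Delta> \<Phi> by (simp add: prob_space)
  also have "\<dots> \<le> ?q * (3 * real CARD('n)) + 1"
  proof -
    \<comment> \<open>The contraction factor must be nonnegative for the induction hypothesis to be
      multiplied by it.\<close>
    have "real CARD('n) \<ge> 1" by (simp add: Suc_leI)
    then have "1 \<le> 3 * real CARD('n)" by linarith
    then have "?q \<ge> 0" by simp
    then show ?thesis using step.IH by (intro add_right_mono mult_left_mono)
  qed
  also have "\<dots> = 3 * real CARD('n)"
    by (simp add: field_simps)
  finally show ?case .
qed

text \<open>A coordinate beyond the threshold has a summand larger than \<open>a\<close>, half the
  argument of the logarithm, because \<open>cosh\<close> is at least half of \<open>exp\<close>.
  Markov's inequality at level \<open>a\<close> then applies.\<close>

lemma prob_infnorm_x_gt_le:
  assumes strategy: "argmax_strategy pick" and k: "k \<ge> 1" and p: "p > 0"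
  shows "prob {\<omega> \<in> space M. 2 * (c + R) * ln (4 * real CARD('n) * (real k)\<^sup>2 / p) < infnorm (x k \<omega>)}
          \<le> 3 * p / (2 * (real k)\<^sup>2)"
proof -
  define l where "l = 1 / (2 * (c + R))"
  have l_pos: "l > 0" using c_pos R_pos by (simp add: l_def)
  define a where "a = 2 * real CARD('n) * (real k)\<^sup>2 / p"
  have a_pos: "a > 0" using k p by (simp add: a_def)
  have "{\<omega> \<in> space M. 2 * (c + R) * ln (4 * real CARD('n) * (real k)\<^sup>2 / p) < infnorm (x k \<omega>)}
      \<subseteq> {\<omega> \<in> space M. a \<le> potential l (x k \<omega>)}"
  proof safe
    fix \<omega> assume "2 * (c + R) * ln (4 * real CARD('n) * (real k)\<^sup>2 / p) < infnorm (x k \<omega>)"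
    moreover have "2 * (c + R) = 1 / l" using c_pos R_pos by (simp add: l_def)
    moreover have "4 * real CARD('n) * (real k)\<^sup>2 / p = 2 * a" by (simp add: a_def)
    ultimately have "ln (2 * a) / l < infnorm (x k \<omega>)" by simp
    then obtain j where "ln (2 * a) / l < \<bar>x k \<omega> $ j\<bar>"
      using infnorm_le_iff_cart[of "x k \<omega>" "ln (2 * a) / l"] by (auto simp: not_le)
    then have "ln (2 * a) < l * \<bar>x k \<omega> $ j\<bar>" using l_pos by (simp add: field_simps)
    then have "exp (ln (2 * a)) < exp (l * \<bar>x k \<omega> $ j\<bar>)" by simp
    then have "2 * a < exp (l * \<bar>x k \<omega> $ j\<bar>)" using a_pos by simp
    also have "\<dots> \<le> 2 * cosh (l * \<bar>x k \<omega> $ j\<bar>)" by (simp add: cosh_field_def)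
    also have "cosh (l * \<bar>x k \<omega> $ j\<bar>) = cosh (l * x k \<omega> $ j)"
      using cosh_real_abs[of "l * x k \<omega> $ j"] l_pos by (simp add: abs_mult)
    also have "\<dots> \<le> potential l (x k \<omega>)"
      unfolding potential_def by (rule member_le_sum) auto
    finally show "a \<le> potential l (x k \<omega>)" by simp
  qed
  then have "prob {\<omega> \<in> space M. 2 * (c + R) * ln (4 * real CARD('n) * (real k)\<^sup>2 / p) < infnorm (x k \<omega>)}
      \<le> prob {\<omega> \<in> space M. a \<le> potential l (x k \<omega>)}"
    using potential_measurable[OF k, of l] by (intro finite_measure_mono) auto
  also have "\<dots> \<le> expectation (\<lambda>\<omega>. potential l (x k \<omega>)) / a"
    using potential_integrable[OF k, of l] l_pos a_pos
    by (intro integral_Markov_inequality_measure[where A = "space M"])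
       (auto simp: potential_def sum_nonneg)
  also have "\<dots> \<le> 3 * real CARD('n) / a"
    using expectation_potential_le[OF strategy l_def k] a_pos by (intro divide_right_mono) auto
  also have "\<dots> = 3 * p / (2 * (real k)\<^sup>2)"
    using k p by (simp add: a_def field_simps)
  finally show ?thesis .
qed

end

section \<open>Summing the failure probabilities over the rounds\<close>

text \<open>Comparing \<open>1 / k\<^sup>2\<close> with \<open>1 / (k\<^sup>2 - 1/4)\<close> makes the sum telescope.\<close>
lemma inverse_square_tail_bound:
  defines "f \<equiv> \<lambda>n::nat. 1 / (real n + 3 / 2)"
  shows "1 / (real (n + 2))\<^sup>2 \<le> f n - f (Suc n)" "(\<lambda>n. f n - f (Suc n)) sums (2 / 3)"
proof -
  have "f n - f (Suc n) = 1 / ((real n + 3 / 2) * (real n + 5 / 2))"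
    by (simp add: f_def field_simps)
  moreover have "1 / (real (n + 2))\<^sup>2 \<le> 1 / ((real n + 3 / 2) * (real n + 5 / 2))"
  proof (rule divide_left_mono)
    show "(real n + 3 / 2) * (real n + 5 / 2) \<le> (real (n + 2))\<^sup>2"
      by (simp add: power2_eq_square algebra_simps)
    show "0 < (real (n + 2))\<^sup>2 * ((real n + 3 / 2) * (real n + 5 / 2))"
      by (intro mult_pos_pos zero_less_power) linarith+
  qed simp
  ultimately show "1 / (real (n + 2))\<^sup>2 \<le> f n - f (Suc n)" by simp
  have "f \<longlonglongrightarrow> 0"
    unfolding f_def by real_asymp
  from telescope_sums'[OF this] show "(\<lambda>n. f n - f (Suc n)) sums (2 / 3)"
    by (simp add: f_def)
qed

theorem mainTheorem4:
  fixes M :: "'a measure" and F :: "nat \<Rightarrow> 'a measure"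
    and c R p :: real
    and D :: "nat \<Rightarrow> 'a \<Rightarrow> (real ^ 'n) measure"
    and pick :: "nat \<Rightarrow> real ^ 'n \<Rightarrow> 'n::finite"
    and x y \<Delta> :: "nat \<Rightarrow> 'a \<Rightarrow> real ^ 'n"
  assumes "stochastic_chasing_zero_game M F c R D y pick \<Delta> x"
    and "argmax_strategy pick"
    and "0 < p" and "p < 1"
  shows "measure M {\<omega> \<in> space M. \<forall>k\<ge>1.
           infnorm (x k \<omega>) \<le> 2 * (c + R) * ln (4 * real CARD('n) * (real k)\<^sup>2 / p)} \<ge> 1 - p"
proof -
  interpret stochastic_chasing_zero_game M F c R D y pick \<Delta> x by fact
  define t where "t k = 2 * (c + R) * ln (4 * real CARD('n) * (real k)\<^sup>2 / p)" for k :: nat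
  \<comment> \<open>Index \<open>n\<close> stands for round \<open>n + 2\<close>; round 1 needs no
    share of \<open>p\<close>.\<close>
  define bad where "bad n = {\<omega> \<in> space M. t (n + 2) < infnorm (x (n + 2) \<omega>)}" for n
  \<comment> \<open>A telescoping majorant of the Markov bound for round
    \<open>n + 2\<close>.\<close>
  define b where "b n = 3 * p / 2 * (1 / (real n + 3 / 2) - 1 / (real (Suc n) + 3 / 2))" for n
  have bad_sets [measurable]: "bad n \<in> sets M" for n
  proof -
    have "infnorm \<in> borel_measurable (borel :: (real ^ 'n) measure)"
      by (intro borel_measurable_continuous_onI continuous_intros)
    moreover have "x (n + 2) \<in> borel_measurable M"
      by (rule measurable_M_of_F[OF x_measurable]) simp
    ultimately have [measurable]: "(\<lambda>\<omega>. infnorm (x (n + 2) \<omega>)) \<in> borel_measurable M"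
      by (rule measurable_compose[rotated])
    show ?thesis unfolding bad_def by measurable
  qed
  have bad_le: "prob (bad n) \<le> b n" for n
  proof -
    have "prob (bad n) \<le> 3 * p / (2 * (real (n + 2))\<^sup>2)"
      unfolding bad_def t_def by (rule prob_infnorm_x_gt_le) (use assms in auto)
    also have "\<dots> = 3 * p / 2 * (1 / (real (n + 2))\<^sup>2)" by simp
    also have "\<dots> \<le> b n"
      unfolding b_def using inverse_square_tail_bound(1)[of n] assms by (intro mult_left_mono) auto
    finally show ?thesis .
  qed
  \<comment> \<open>The telescoping total 2/3 cancels the factor 3/2 from Markov's inequality, so
    the majorants sum to exactly \<open>p\<close>.\<close>
  have "b sums (3 * p / 2 * (2 / 3))"
    unfolding b_def by (intro sums_mult inverse_square_tail_bound(2))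
  then have b: "b sums p" by simp
  have summable: "summable (\<lambda>n. prob (bad n))"
    by (rule summable_comparison_test'[OF sums_summable[OF b], of 0]) (simp add: bad_le)
  have "prob (\<Union>n. bad n) \<le> (\<Sum>n. prob (bad n))"
    by (intro finite_measure_subadditive_countably summable) auto
  also have "\<dots> \<le> (\<Sum>n. b n)"
    by (intro suminf_le bad_le summable sums_summable[OF b])
  also have "\<dots> = p" using b by (simp add: sums_iff)
  finally have "1 - p \<le> prob (space M - (\<Union>n. bad n))"
    by (subst prob_compl) auto
  also have "space M - (\<Union>n. bad n) = {\<omega> \<in> space M. \<forall>k\<ge>1. infnorm (x k \<omega>) \<le> t k}"
  proof (intro set_eqI iffI)
    fix \<omega> assume \<omega>: "\<omega> \<in> space M - (\<Union>n. bad n)"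
    have "infnorm (x k \<omega>) \<le> t k" if "k \<ge> 1" for k
    proof (cases "k = 1")
      case True
      \<comment> \<open>Since \<open>p\<close> is below 4m, the logarithm in \<open>t 1\<close> is
        nonnegative, whereas \<open>x 1\<close> is 0.\<close>
      have "real CARD('n) \<ge> 1" by (simp add: Suc_leI)
      then have "p \<le> 4 * real CARD('n)" using assms(4) by linarith
      then have "4 * real CARD('n) / p \<ge> 1" using assms(3) by simp
      then have "t 1 \<ge> 0" using c_pos R_pos by (simp add: t_def)
      then show ?thesis using True \<omega> x_start by (simp add: infnorm_0)
    next
      case False
      \<comment> \<open>Here \<open>k \<ge> 2\<close>, so the truncated subtraction loses
        nothing.\<close>
      then have "\<omega> \<notin> bad (k - 2)" "k - 2 + 2 = k" using \<omega> that by auto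
      then show ?thesis using \<omega> by (simp add: bad_def not_less)
    qed
    then show "\<omega> \<in> {\<omega> \<in> space M. \<forall>k\<ge>1. infnorm (x k \<omega>) \<le> t k}" using \<omega> by simp
  qed (auto simp: bad_def not_less)
  finally show ?thesis unfolding t_def .
qed

end
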